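(* Let $G=(X,\Sigma,\delta,X_0)$ be a non-deterministic finite-state automaton with $\Sigma=\Sigma_o\,\dot\cup\,\Sigma_{uo}$, let $\Gamma\subseteq\Sigma_o$ be a set of anonymous events with $|\Gamma|\ge 2$, let $P_{str}$ be the strong anonymous projection, and let $Cc(G_m,Obs_m(G))=(X_c,\Sigma_c,\delta_c,X_{0,c})$ be the concurrent composition of $G_m$ and the modified observer $Obs_m(G)$. Then: (i) $G$ is infinite-step strongly anonymous w.r.t. $\Sigma_o$, $\Gamma$ and $P_{str}$ if and only if no state of the form $(\cdot,\emptyset)$ in $Cc(G_m,Obs_m(G))$ is reachable from $X_{0,c}$; (ii) for every $K\in\mathbb{N}$, $G$ is $K$-step strongly anonymous w.r.t. $\Sigma_o$, $\Gamma$ and $P_{str}$ if and only if no state of the form $(\cdot,\emptyset)$ in $Cc(G_m,Obs_m(G))$ is reachable from $X_{0,c}$ within $K$ observational steps.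
   Context: $\mathbb{N}$ is the set of non-negative integers and $\epsilon$ the empty string. A non-deterministic finite-state automaton (NFA) is $G=(X,\Sigma,\delta,X_0)$ with finite state set $X$, finite event set $\Sigma$, transition function $\delta:X\times\Sigma\to 2^X$ (extended to $X\times\Sigma^*$ in the usual way, with $\delta(x,\epsilon)=\{x\}$), and initial states $X_0\subseteq X$. $\mathcal{L}(G,x)=\{s\in\Sigma^*\mid\delta(x,s)\ne\emptyset\}$ and $\mathcal{L}(G)=\bigcup_{x_0\in X_0}\mathcal{L}(G,x_0)$. $\Sigma_o$ and $\Sigma_{uo}$ are the observable and unobservable events. Strong anonymous projection: fix a symbol $\gamma\notin\Sigma$. $P_{str}:\Sigma^*\to(\Sigma_o\cup\{\gamma\})^*$ is given by $P_{str}(\epsilon)=\epsilon$ and $P_{str}(s\sigma)=P_{str}(s)\gamma$ if $\sigma\in\Gamma$; $=P_{str}(s)\sigma$ if $\sigma\in\Sigma_o\setminus\Gamma$; $=P_{str}(s)$ if $\sigma\in\Sigma_{uo}$. Delayed state estimate, for $\alpha\beta\in P_{str}(\mathcal{L}(G))$: $$\widehat{E}_G(P_{str},\alpha|\alpha\beta)=\{x\in X\mid [\exists x_0\in X_0,\exists s\in\mathcal{L}(G,x_0): P_{str}(s)=\alpha\wedge x\in\delta(x_0,s)]\wedge[\exists t\in\mathcal{L}(G,x):P_{str}(st)=\alpha\beta]\}.$$ $G$ is $K$-step strongly anonymous w.r.t. $\Sigma_o,\Gamma,P_{str}$ if for all $st\in\mathcal{L}(G)$ with $P_{str}(s)=\alpha$,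 $P_{str}(st)=\alpha\beta$ and $|\beta|\le K$, one has $|\widehat{E}_G(P_{str},\alpha|\alpha\beta)|>1$. It is infinite-step strongly anonymous if this holds with no restriction on $|\beta|$. Unobservable reach of $Q\subseteq X$: $UR(Q)=\{q'\in X\mid\exists q\in Q,\exists s\in\Sigma_{uo}^*:q'\in\delta(q,s)\}$. Observer: $Obs(G)=(X_{obs},\Sigma_{obs},\delta_{obs},X_{0,obs})$ is the deterministic automaton with $X_{obs}=2^X$, $\Sigma_{obs}=(\Sigma_o\setminus\Gamma)\cup\{\gamma\}$, initial state $X_{0,obs}=UR(X_0)$, and total transition function $\delta_{obs}(q,\gamma)=UR(\{x'\mid\exists x\in q,\exists\sigma\in\Gamma:x'\in\delta(x,\sigma)\})$, $\delta_{obs}(q,\sigma)=UR(\{x'\mid\exists x\in q:x'\in\delta(x,\sigma)\})$ for $\sigma\in\Sigma_o\setminus\Gamma$. Let $\bar X_{obs}$ be the set of its states reachable from $X_{0,obs}$. Adjoint state set: for $x\in x_{obs}\in X_{obs}$, $As(x,x_{obs})=UR(x_{obs}\setminus\{x\})$. Modified observer: $Obs_m(G)$ has the same state set $2^X$, event set $\Sigma_{obs}$ and transition function (written $\delta_m$) as $Obs(G)$, but its set of initial states is $X_{0,m}=\{As(x,x_{obs})\mid x\in x_{obs},\ \emptyset\ne x_{obs}\in\bar X_{obs}\}$. $G_m$ is $G$ with all states declared initial. Concurrent composition: $Cc(G_m,Obs_m(G))=(X_c,\Sigma_c,\delta_c,X_{0,c})$, where $X_c=X\times 2^X$; $\Sigma_c=\{(\sigma,P_{str}(\sigma))\mid\sigma\in\Sigma_o\}\cup\{(\sigma,\epsilon)\mid\sigma\in\Sigma_{uo}\}$;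 for $\sigma\in\Sigma_o$, $(x',q')\in\delta_c((x,q),(\sigma,P_{str}(\sigma)))$ iff $x'\in\delta(x,\sigma)$ and $q'=\delta_m(q,P_{str}(\sigma))$; for $\sigma\in\Sigma_{uo}$, $(x',q')\in\delta_c((x,q),(\sigma,\epsilon))$ iff $x'\in\delta(x,\sigma)$ and $q'=q$; and $X_{0,c}=\{(x,As(x,x_{obs}))\mid x\in x_{obs},\ \emptyset\ne x_{obs}\in\bar X_{obs}\}$. For a string $s_c$ over $\Sigma_c$, $R(s_c)$ is the concatenation of the second components of its letters. A state is reachable from $X_{0,c}$ within $K$ observational steps if it belongs to $\delta_c(x_{0,c},s_c)$ for some $x_{0,c}\in X_{0,c}$ and some string $s_c$ (possibly empty) with $|R(s_c)|\le K$. "Of the form $(\cdot,\emptyset)$" means that the second component is the empty set. *)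

theory Defs
  imports Main
begin

record ('x, 'e) nfa =
  states :: "'x set"
  events :: "'e set"
  trans :: "'x \<Rightarrow> 'e \<Rightarrow> 'x set"
  init :: "'x set"

definition is_nfa :: "('x, 'e) nfa \<Rightarrow> bool" where
  "is_nfa G \<longleftrightarrow>
     finite (states G) \<and> finite (events G) \<and> init G \<subseteq> states G \<and>
     (\<forall>x\<in>states G. \<forall>\<sigma>\<in>events G. trans G x \<sigma> \<subseteq> states G)"

primrec trans_ext :: "('x, 'e) nfa \<Rightarrow> 'x \<Rightarrow> 'e list \<Rightarrow> 'x set" where
  "trans_ext G x [] = {x}"
| "trans_ext G x (\<sigma> # s) = (\<Union>x'\<in>trans G x \<sigma>. trans_ext G x' s)"

definition lang_from :: "('x, 'e) nfa \<Rightarrow> 'x \<Rightarrow> 'e list set" where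
  "lang_from G x = {s \<in> lists (events G). trans_ext G x s \<noteq> {}}"

definition lang :: "('x, 'e) nfa \<Rightarrow> 'e list set" where
  "lang G = (\<Union>x0\<in>init G. lang_from G x0)"

definition reachable :: "('x, 'e) nfa \<Rightarrow> 'x set" where
  "reachable G = {x. \<exists>x0\<in>init G. \<exists>s\<in>lists (events G). x \<in> trans_ext G x0 s}"

text \<open>
  The observable alphabet: an observable event seen as itself, or the symbol
  \<open>Anon\<close>, written gamma in the mathematical text. The datatype makes this symbol fresh
  for every event set.
\<close>

datatype 'e obs_sym = Anon | Ev 'e

definition P_sym :: "'e set \<Rightarrow> 'e set \<Rightarrow> 'e \<Rightarrow> 'e obs_sym list" where
  "P_sym So \<Gamma> \<sigma> = (if \<sigma> \<in> \<Gamma> then [Anon] else if \<sigma> \<in> So then [Ev \<sigma>] else [])"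

definition P_str :: "'e set \<Rightarrow> 'e set \<Rightarrow> 'e list \<Rightarrow> 'e obs_sym list" where
  "P_str So \<Gamma> s = concat (map (P_sym So \<Gamma>) s)"

lemma P_str_Nil: "P_str So \<Gamma> [] = []"
  by (simp add: P_str_def)

lemma P_str_snoc:
  assumes "So \<inter> Suo = {}" and "\<Gamma> \<subseteq> So"
  shows "\<sigma> \<in> \<Gamma> \<Longrightarrow> P_str So \<Gamma> (s @ [\<sigma>]) = P_str So \<Gamma> s @ [Anon]"
    and "\<sigma> \<in> So - \<Gamma> \<Longrightarrow> P_str So \<Gamma> (s @ [\<sigma>]) = P_str So \<Gamma> s @ [Ev \<sigma>]"
    and "\<sigma> \<in> Suo \<Longrightarrow> P_str So \<Gamma> (s @ [\<sigma>]) = P_str So \<Gamma> s"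
  using assms by (auto simp: P_str_def P_sym_def)

text \<open>
  The second word argument \<open>\<omega>\<close> of the delayed state estimate is the whole observation, of
  which \<open>\<alpha>\<close> is a prefix.
\<close>

definition delayed_estimate ::
    "('x, 'e) nfa \<Rightarrow> 'e set \<Rightarrow> 'e set \<Rightarrow> 'e obs_sym list \<Rightarrow> 'e obs_sym list \<Rightarrow> 'x set" where
  "delayed_estimate G So \<Gamma> \<alpha> \<omega> =
     {x \<in> states G. \<exists>x0\<in>init G. \<exists>s\<in>lang_from G x0.
        P_str So \<Gamma> s = \<alpha> \<and> x \<in> trans_ext G x0 s \<and>
        (\<exists>t\<in>lang_from G x. P_str So \<Gamma> (s @ t) = \<omega>)}"

definition K_step_strongly_anonymous ::
    "('x, 'e) nfa \<Rightarrow> 'e set \<Rightarrow> 'e set \<Rightarrow> nat \<Rightarrow> bool" where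
  "K_step_strongly_anonymous G So \<Gamma> K \<longleftrightarrow>
     (\<forall>s t \<alpha> \<beta>. s @ t \<in> lang G \<and> P_str So \<Gamma> s = \<alpha> \<and> P_str So \<Gamma> (s @ t) = \<alpha> @ \<beta> \<and> length \<beta> \<le> K
        \<longrightarrow> card (delayed_estimate G So \<Gamma> \<alpha> (\<alpha> @ \<beta>)) > 1)"

definition infinite_step_strongly_anonymous ::
    "('x, 'e) nfa \<Rightarrow> 'e set \<Rightarrow> 'e set \<Rightarrow> bool" where
  "infinite_step_strongly_anonymous G So \<Gamma> \<longleftrightarrow>
     (\<forall>s t \<alpha> \<beta>. s @ t \<in> lang G \<and> P_str So \<Gamma> s = \<alpha> \<and> P_str So \<Gamma> (s @ t) = \<alpha> @ \<beta>
        \<longrightarrow> card (delayed_estimate G So \<Gamma> \<alpha> (\<alpha> @ \<beta>)) > 1)"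

definition UR :: "('x, 'e) nfa \<Rightarrow> 'e set \<Rightarrow> 'x set \<Rightarrow> 'x set" where
  "UR G Suo Q = {q' \<in> states G. \<exists>q\<in>Q. \<exists>s\<in>lists Suo. q' \<in> trans_ext G q s}"

text \<open>
  Automata with a total deterministic transition function but a set of initial states. The
  observer has exactly one initial state, the modified observer may have several.
\<close>

record ('q, 'a) det_automaton =
  det_states :: "'q set"
  det_events :: "'a set"
  det_trans :: "'q \<Rightarrow> 'a \<Rightarrow> 'q"
  det_init :: "'q set"

definition det_trans_ext :: "('q, 'a) det_automaton \<Rightarrow> 'q \<Rightarrow> 'a list \<Rightarrow> 'q" where
  "det_trans_ext A q w = foldl (det_trans A) q w"

definition det_reachable :: "('q, 'a) det_automaton \<Rightarrow> 'q set" where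
  "det_reachable A = {det_trans_ext A q0 w |q0 w. q0 \<in> det_init A \<and> w \<in> lists (det_events A)}"

definition Obs ::
    "('x, 'e) nfa \<Rightarrow> 'e set \<Rightarrow> 'e set \<Rightarrow> 'e set \<Rightarrow> ('x set, 'e obs_sym) det_automaton" where
  "Obs G So Suo \<Gamma> =
     \<lparr> det_states = Pow (states G),
       det_events = Ev ` (So - \<Gamma>) \<union> {Anon},
       det_trans = (\<lambda>q a. case a of
           Anon \<Rightarrow> UR G Suo {x'. \<exists>x\<in>q. \<exists>\<sigma>\<in>\<Gamma>. x' \<in> trans G x \<sigma>}
         | Ev \<sigma> \<Rightarrow> UR G Suo {x'. \<exists>x\<in>q. x' \<in> trans G x \<sigma>}),
       det_init = {UR G Suo (init G)} \<rparr>"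

definition As :: "('x, 'e) nfa \<Rightarrow> 'e set \<Rightarrow> 'x \<Rightarrow> 'x set \<Rightarrow> 'x set" where
  "As G Suo x q = UR G Suo (q - {x})"

definition Obs_m ::
    "('x, 'e) nfa \<Rightarrow> 'e set \<Rightarrow> 'e set \<Rightarrow> 'e set \<Rightarrow> ('x set, 'e obs_sym) det_automaton" where
  "Obs_m G So Suo \<Gamma> = (Obs G So Suo \<Gamma>)
     \<lparr> det_init := {As G Suo x q |x q. x \<in> q \<and> q \<noteq> {} \<and> q \<in> det_reachable (Obs G So Suo \<Gamma>)} \<rparr>"

definition all_init :: "('x, 'e) nfa \<Rightarrow> ('x, 'e) nfa" where
  "all_init G = G\<lparr> init := states G \<rparr>"

text \<open>
  The concurrent composition of \<open>all_init G\<close> and \<open>Obs_m G\<close>. Each event is a pair of an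
  event of \<open>G\<close> and its projection, a word of length at most one. The initial states are
  only the pairs in which both components come from the same observer state.
\<close>

definition Cc ::
    "('x, 'e) nfa \<Rightarrow> 'e set \<Rightarrow> 'e set \<Rightarrow> 'e set \<Rightarrow>
     ('x \<times> 'x set, 'e \<times> 'e obs_sym list) nfa" where
  "Cc G So Suo \<Gamma> =
     \<lparr> states = states (all_init G) \<times> det_states (Obs_m G So Suo \<Gamma>),
       events = {(\<sigma>, P_str So \<Gamma> [\<sigma>]) |\<sigma>. \<sigma> \<in> So} \<union> {(\<sigma>, []) |\<sigma>. \<sigma> \<in> Suo},
       trans = (\<lambda>(x, q) (\<sigma>, w).
         if \<sigma> \<in> So \<and> w = P_str So \<Gamma> [\<sigma>] then
           {(x', q'). x' \<in> trans (all_init G) x \<sigma> \<and>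
                      q' = det_trans_ext (Obs_m G So Suo \<Gamma>) q (P_str So \<Gamma> [\<sigma>])}
         else if \<sigma> \<in> Suo \<and> w = [] then
           {(x', q'). x' \<in> trans (all_init G) x \<sigma> \<and> q' = q}
         else {}),
       init = {(x, As G Suo x q) |x q.
                 x \<in> q \<and> q \<noteq> {} \<and> q \<in> det_reachable (Obs G So Suo \<Gamma>)} \<rparr>"

definition R :: "('e \<times> 'e obs_sym list) list \<Rightarrow> 'e obs_sym list" where
  "R w = concat (map snd w)"

definition reachable_within ::
    "nat \<Rightarrow> ('y, 'e \<times> 'e obs_sym list) nfa \<Rightarrow> 'y set" where
  "reachable_within K C =
     {y. \<exists>y0\<in>init C. \<exists>w\<in>lists (events C). length (R w) \<le> K \<and> y \<in> trans_ext C y0 w}"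

end

(* The observer run on w started in UR Q computes the set post Q w of all states reached from Q by
   words with observation w, and the composition pairs a run of G with the observer run on its
   observation. Hence, from (x, As x q) with q = post init \<alpha>, a state (z, {}) is reached
   exactly when some continuation of x with observation \<beta> is matched by no other state of q,
   that is, when the delayed estimate of \<alpha> given \<alpha>\<beta> is {x}. *)
theory Submission
  imports Defs
begin

section \<open>Words, projections and the reduction to bounded delay\<close>

lemma trans_ext_append:
  "trans_ext G x (s @ t) = (\<Union>y\<in>trans_ext G x s. trans_ext G y t)"
  by (induction s arbitrary: x) auto

lemma P_str_simps [simp]:
  "P_str So \<Gamma> [] = []"
  "P_str So \<Gamma> (\<sigma> # s) = P_sym So \<Gamma> \<sigma> @ P_str So \<Gamma> s"
  "P_str So \<Gamma> (s @ t) = P_str So \<Gamma> s @ P_str So \<Gamma> t"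
  by (simp_all add: P_str_def)

lemma det_trans_ext_simps [simp]:
  "det_trans_ext A q [] = q"
  "det_trans_ext A q (a # w) = det_trans_ext A (det_trans A q a) w"
  by (simp_all add: det_trans_ext_def)

lemma det_trans_ext_Obs_m [simp]:
  "det_trans_ext (Obs_m G So Suo \<Gamma>) = det_trans_ext (Obs G So Suo \<Gamma>)"
  by (simp add: fun_eq_iff det_trans_ext_def Obs_m_def)

text \<open>A single word has a projection of finite length, which serves as \<open>K\<close>. With
  the analogous remark on \<beta> in the next lemma, the infinite-step claim follows from the
  \<open>K\<close>-step claim.\<close>

lemma reachable_iff_reachable_within:
  "y \<in> reachable C \<longleftrightarrow> (\<exists>K. y \<in> reachable_within K C)"
  by (auto simp: reachable_def reachable_within_def)

lemma infinite_step_iff_K_step: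
  "infinite_step_strongly_anonymous G So \<Gamma> \<longleftrightarrow> (\<forall>K. K_step_strongly_anonymous G So \<Gamma> K)"
  unfolding infinite_step_strongly_anonymous_def K_step_strongly_anonymous_def by blast

locale partially_observed_nfa =
  fixes G :: "('x, 'e) nfa" and So Suo \<Gamma> :: "'e set"
  assumes is_nfa: "is_nfa G"
    and events_eq: "events G = So \<union> Suo"
    and disjoint: "So \<inter> Suo = {}"
    and anon_subset: "\<Gamma> \<subseteq> So"
begin

abbreviation obs :: "'e list \<Rightarrow> 'e obs_sym list" where
  "obs \<equiv> P_str So \<Gamma>"

text \<open>Words may begin and end with unobservable events, so \<open>post Q []\<close> is the
  unobservable closure of \<open>Q\<close>, and \<open>post (init G) \<alpha>\<close> is the
  current-state estimate after observing \<alpha>.\<close>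

definition post :: "'x set \<Rightarrow> 'e obs_sym list \<Rightarrow> 'x set" where
  "post Q w = {x. \<exists>y\<in>Q. \<exists>s\<in>lists (events G). obs s = w \<and> x \<in> trans_ext G y s}"

definition step :: "'x set \<Rightarrow> 'e obs_sym \<Rightarrow> 'x set" where
  "step Q a = {x'. \<exists>x\<in>Q. \<exists>\<sigma>\<in>So. P_sym So \<Gamma> \<sigma> = [a] \<and> x' \<in> trans G x \<sigma>}"

section \<open>Splitting words by their observation\<close>

lemma P_sym_uo [simp]: "\<sigma> \<in> Suo \<Longrightarrow> P_sym So \<Gamma> \<sigma> = []"
  using disjoint anon_subset by (auto simp: P_sym_def)

lemma P_sym_o: "\<sigma> \<in> So \<Longrightarrow> \<exists>a \<in> det_events (Obs G So Suo \<Gamma>). P_sym So \<Gamma> \<sigma> = [a]"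
  by (auto simp: P_sym_def Obs_def)

lemma obs_in_lists:
  "s \<in> lists (events G) \<Longrightarrow> obs s \<in> lists (det_events (Obs G So Suo \<Gamma>))"
proof (induction s rule: list.induct)
  case (Cons \<sigma> s)
  then show ?case using P_sym_o[of \<sigma>] by (cases "\<sigma> \<in> So") (auto simp: events_eq)
qed simp

lemma obs_eq_Nil_iff:
  "s \<in> lists (events G) \<Longrightarrow> obs s = [] \<longleftrightarrow> s \<in> lists Suo"
proof (induction s rule: list.induct)
  case (Cons \<sigma> s)
  then show ?case
    using P_sym_o[of \<sigma>] disjoint by (cases "\<sigma> \<in> So") (auto simp: events_eq)
qed simp

text \<open>The word is cut at its first observable event: all before it is invisible, so this event
  must produce \<open>a\<close>.\<close>

lemma obs_eq_Cons:
  assumes "s \<in> lists (events G)" "obs s = a # w"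
  obtains u \<sigma> v where "s = u @ \<sigma> # v" "u \<in> lists Suo" "\<sigma> \<in> So" "P_sym So \<Gamma> \<sigma> = [a]"
    "v \<in> lists (events G)" "obs v = w"
proof -
  have "\<exists>u \<sigma> v. s = u @ \<sigma> # v \<and> u \<in> lists Suo \<and> \<sigma> \<in> So \<and> P_sym So \<Gamma> \<sigma> = [a] \<and>
     v \<in> lists (events G) \<and> obs v = w"
    using assms
  proof (induction s rule: list.induct)
    case Nil
    then show ?case by simp
  next
    case (Cons \<tau> s)
    show ?case
    proof (cases "\<tau> \<in> So")
      case True
      then obtain b where "P_sym So \<Gamma> \<tau> = [b]" using P_sym_o by blast
      with Cons.prems have "P_sym So \<Gamma> \<tau> = [a]" "obs s = w" by auto
      with True Cons.prems have "\<tau> # s = [] @ \<tau> # s \<and> [] \<in> lists Suo \<and> \<tau> \<in> So \<and>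
          P_sym So \<Gamma> \<tau> = [a] \<and> s \<in> lists (events G) \<and> obs s = w" by simp
      then show ?thesis by blast
    next
      case False
      then have "\<tau> \<in> Suo" using Cons.prems events_eq by auto
      with Cons obtain u \<sigma> v where "s = u @ \<sigma> # v" "u \<in> lists Suo" "\<sigma> \<in> So"
        "P_sym So \<Gamma> \<sigma> = [a]" "v \<in> lists (events G)" "obs v = w" by auto
      with \<open>\<tau> \<in> Suo\<close> have "\<tau> # s = (\<tau> # u) @ \<sigma> # v \<and> \<tau> # u \<in> lists Suo \<and> \<sigma> \<in> So \<and>
          P_sym So \<Gamma> \<sigma> = [a] \<and> v \<in> lists (events G) \<and> obs v = w" by simp
      then show ?thesis by blast
    qed
  qed
  then show ?thesis using that by blast
qed

section \<open>The observer computes \<open>post\<close>\<close>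

lemma trans_ext_subset_states:
  "x \<in> states G \<Longrightarrow> s \<in> lists (events G) \<Longrightarrow> trans_ext G x s \<subseteq> states G"
proof (induction s arbitrary: x)
  case (Cons \<sigma> s)
  then have "trans G x \<sigma> \<subseteq> states G" using is_nfa by (auto simp: is_nfa_def)
  with Cons show ?case by auto
qed simp

lemma lists_uo_subset: "s \<in> lists Suo \<Longrightarrow> s \<in> lists (events G)"
  by (auto simp: events_eq)

lemma post_subset_states: "Q \<subseteq> states G \<Longrightarrow> post Q w \<subseteq> states G"
  using trans_ext_subset_states by (auto simp: post_def)

text \<open>Unobservable words are exactly the words over \<open>events G\<close> with empty
  projection. \<open>UR\<close> intersects with \<open>states G\<close> and \<open>post\<close> does
  not, but runs from \<open>Q\<close> never leave \<open>states G\<close>.\<close>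

lemma UR_eq_post: "Q \<subseteq> states G \<Longrightarrow> UR G Suo Q = post Q []"
  using trans_ext_subset_states lists_uo_subset obs_eq_Nil_iff
  unfolding UR_def post_def by (intro Collect_cong) (meson subsetD)

text \<open>Membership in the alphabet matters for \<open>Ev \<sigma>\<close>: it excludes \<sigma>
  in \<Gamma>, an event that is only ever seen as \<open>Anon\<close>.\<close>

lemma det_trans_Obs:
  "a \<in> det_events (Obs G So Suo \<Gamma>) \<Longrightarrow>
     det_trans (Obs G So Suo \<Gamma>) Q a = UR G Suo (step Q a)"
  using anon_subset unfolding Obs_def step_def P_sym_def
  by (cases a) (auto intro!: arg_cong[of _ _ "UR G Suo"] split: if_splits)

lemma step_subset_states: "Q \<subseteq> states G \<Longrightarrow> step Q a \<subseteq> states G"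
  using is_nfa events_eq unfolding step_def is_nfa_def by blast

text \<open>Cutting a word around its first observable event gives the three stages on the right.
  This recursion mirrors one observer transition.\<close>

lemma post_Cons:
  "post Q (a # w) = post (step (post Q []) a) w" (is "?L = ?R")
proof
  show "?L \<subseteq> ?R"
  proof
    fix x assume "x \<in> ?L"
    then obtain y s where y: "y \<in> Q" and s: "s \<in> lists (events G)" "obs s = a # w"
      and x: "x \<in> trans_ext G y s" by (auto simp: post_def)
    from s obtain u \<sigma> v where d: "s = u @ \<sigma> # v" "u \<in> lists Suo" "\<sigma> \<in> So"
      "P_sym So \<Gamma> \<sigma> = [a]" "v \<in> lists (events G)" "obs v = w" by (rule obs_eq_Cons)
    with x obtain p p' where p: "p \<in> trans_ext G y u" "p' \<in> trans G p \<sigma>" "x \<in> trans_ext G p' v"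
      by (auto simp: trans_ext_append)
    have "u \<in> lists (events G)" "obs u = []"
      using d(2) lists_uo_subset obs_eq_Nil_iff by blast+
    then have "p \<in> post Q []" unfolding post_def using y p(1) by blast
    then have "p' \<in> step (post Q []) a" unfolding step_def using p(2) d(3,4) by blast
    then show "x \<in> ?R" using p(3) d(5,6) unfolding post_def[of _ w] by blast
  qed
next
  show "?R \<subseteq> ?L"
  proof
    fix x assume "x \<in> ?R"
    then obtain y u p \<sigma> p' v where "y \<in> Q" "u \<in> lists (events G)" "obs u = []"
      "p \<in> trans_ext G y u" "\<sigma> \<in> So" "P_sym So \<Gamma> \<sigma> = [a]" "p' \<in> trans G p \<sigma>"
      "v \<in> lists (events G)" "obs v = w" "x \<in> trans_ext G p' v"
      unfolding post_def step_def by blast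
    then show "x \<in> ?L" unfolding post_def
      by (intro CollectI bexI[of _ y] bexI[of _ "u @ \<sigma> # v"])
         (auto simp: trans_ext_append events_eq)
  qed
qed

text \<open>After reading \<open>a\<close> the observer is in \<open>UR\<close> of
  \<open>step (post Q []) a\<close>, again of the form \<open>UR\<close> of a set of states, so the
  induction runs with \<open>Q\<close> arbitrary.\<close>

lemma det_trans_ext_Obs_UR:
  assumes "Q \<subseteq> states G" "w \<in> lists (det_events (Obs G So Suo \<Gamma>))"
  shows "det_trans_ext (Obs G So Suo \<Gamma>) (UR G Suo Q) w = post Q w"
  using assms
proof (induction w arbitrary: Q)
  case Nil
  then show ?case by (simp add: UR_eq_post)
next
  case (Cons a w)
  then have "step (post Q []) a \<subseteq> states G"
    by (intro step_subset_states post_subset_states)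
  with Cons show ?case by (simp add: det_trans_Obs UR_eq_post[OF Cons.prems(1)] post_Cons[of Q])
qed

lemma det_reachable_Obs:
  "det_reachable (Obs G So Suo \<Gamma>) =
     post (init G) ` lists (det_events (Obs G So Suo \<Gamma>))"
proof -
  have "det_init (Obs G So Suo \<Gamma>) = {UR G Suo (init G)}" by (simp add: Obs_def)
  moreover have "init G \<subseteq> states G" using is_nfa by (simp add: is_nfa_def)
  ultimately show ?thesis
    unfolding det_reachable_def using det_trans_ext_Obs_UR[of "init G"]
    by (simp add: Setcompr_eq_image cong: image_cong_simp)
qed

lemma init_Cc:
  "init (Cc G So Suo \<Gamma>) =
     {(x, As G Suo x (post (init G) \<alpha>)) |x \<alpha>. x \<in> post (init G) \<alpha>}"
proof -
  \<comment> \<open>A state in the estimate comes with a word projecting to \<alpha>, so \<alpha> is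
    automatically a word over the observer alphabet.\<close>
  have "\<alpha> \<in> lists (det_events (Obs G So Suo \<Gamma>))" if "x \<in> post (init G) \<alpha>" for x \<alpha>
    using that obs_in_lists unfolding post_def by blast
  then show ?thesis by (fastforce simp: Cc_def det_reachable_Obs)
qed

section \<open>Runs of the concurrent composition\<close>

definition lift :: "'e list \<Rightarrow> ('e \<times> 'e obs_sym list) list" where
  "lift t = map (\<lambda>\<sigma>. (\<sigma>, P_sym So \<Gamma> \<sigma>)) t"

lemma R_lift: "R (lift t) = obs t"
  by (simp add: R_def lift_def P_str_def comp_def)

text \<open>The second entry of a composition event is determined by the first; for unobservable
  events \<open>P_sym\<close> is the empty word.\<close>

lemma lists_events_Cc: "lists (events (Cc G So Suo \<Gamma>)) = lift ` lists (events G)"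
proof -
  have "events (Cc G So Suo \<Gamma>) = (\<lambda>\<sigma>. (\<sigma>, P_sym So \<Gamma> \<sigma>)) ` events G"
    by (force simp: Cc_def events_eq)
  moreover have "lift = map (\<lambda>\<sigma>. (\<sigma>, P_sym So \<Gamma> \<sigma>))" by (simp add: fun_eq_iff lift_def)
  ultimately show ?thesis by (simp add: lists_image)
qed

text \<open>The first component moves as in \<open>G\<close>. The second is deterministic and
  depends only on the projection, so it is the same for all end states \<open>z\<close>.\<close>

lemma trans_ext_Cc:
  "t \<in> lists (events G) \<Longrightarrow>
     trans_ext (Cc G So Suo \<Gamma>) (x, q) (lift t) =
       {(z, det_trans_ext (Obs G So Suo \<Gamma>) q (obs t)) |z. z \<in> trans_ext G x t}"
proof (induction t arbitrary: x q)
  case Nil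
  then show ?case by (simp add: lift_def)
next
  case (Cons \<sigma> t)
  have "trans (Cc G So Suo \<Gamma>) (x, q) (\<sigma>, P_sym So \<Gamma> \<sigma>) =
      {(x', det_trans_ext (Obs G So Suo \<Gamma>) q (P_sym So \<Gamma> \<sigma>)) |x'. x' \<in> trans G x \<sigma>}"
    using Cons.prems by (auto simp: Cc_def all_init_def events_eq)
  with Cons show ?case
    by (auto simp: lift_def det_trans_ext_def)
qed

lemma reachable_within_Cc_iff:
  "(\<exists>x. (x, {}) \<in> reachable_within K (Cc G So Suo \<Gamma>)) \<longleftrightarrow>
     (\<exists>\<alpha>. \<exists>x \<in> post (init G) \<alpha>. \<exists>t \<in> lang_from G x. length (obs t) \<le> K \<and>
        post (post (init G) \<alpha> - {x}) (obs t) = {})"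
proof -
  have "post (init G) \<alpha> - {x} \<subseteq> states G" for \<alpha> x
    using post_subset_states[of "init G"] is_nfa by (auto simp: is_nfa_def)
  \<comment> \<open>\<open>As\<close> is \<open>UR\<close> of the estimate without \<open>x\<close>,
    so the observer run from it is again a \<open>post\<close>.\<close>
  then have *: "det_trans_ext (Obs G So Suo \<Gamma>) (As G Suo x (post (init G) \<alpha>)) (obs t) =
      post (post (init G) \<alpha> - {x}) (obs t)" if "t \<in> lists (events G)" for \<alpha> x t
    using obs_in_lists[OF that] by (simp add: As_def det_trans_ext_Obs_UR del: in_lists_conv_set)
  have "(\<exists>z. (z, {}) \<in> reachable_within K (Cc G So Suo \<Gamma>)) \<longleftrightarrow>
    (\<exists>\<alpha>. \<exists>x \<in> post (init G) \<alpha>. \<exists>t \<in> lists (events G). length (obs t) \<le> K \<and>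
      (\<exists>z. (z, {}) \<in> trans_ext (Cc G So Suo \<Gamma>) (x, As G Suo x (post (init G) \<alpha>)) (lift t)))"
    unfolding reachable_within_def init_Cc lists_events_Cc Bex_def image_iff mem_Collect_eq
    by (metis R_lift)
  also have "\<dots> \<longleftrightarrow> (\<exists>\<alpha>. \<exists>x \<in> post (init G) \<alpha>. \<exists>t \<in> lists (events G). length (obs t) \<le> K \<and>
      trans_ext G x t \<noteq> {} \<and> post (post (init G) \<alpha> - {x}) (obs t) = {})"
    by (intro ex_cong1 bex_cong refl conj_cong) (auto simp: trans_ext_Cc * simp del: in_lists_conv_set)
  finally show ?thesis unfolding lang_from_def by blast
qed

section \<open>Delayed estimates and anonymity\<close>

text \<open>Projection is a homomorphism, so once \<alpha> is cancelled the condition on the future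
  \<open>t\<close> no longer involves the past \<open>s\<close>.\<close>

lemma delayed_estimate_eq:
  "delayed_estimate G So \<Gamma> \<alpha> (\<alpha> @ \<beta>) =
     {x \<in> post (init G) \<alpha>. \<exists>t\<in>lang_from G x. obs t = \<beta>}"
proof -
  have "post (init G) \<alpha> \<subseteq> states G"
    using is_nfa by (intro post_subset_states) (simp add: is_nfa_def)
  then show ?thesis
    unfolding delayed_estimate_def post_def lang_from_def by auto
qed

lemma post_empty_iff:
  "post Q \<beta> = {} \<longleftrightarrow> (\<forall>y\<in>Q. \<forall>t\<in>lang_from G y. obs t \<noteq> \<beta>)"
  unfolding post_def lang_from_def by auto

lemma append_in_lang_iff:
  "s @ t \<in> lang G \<longleftrightarrow>
     s \<in> lists (events G) \<and> (\<exists>x0\<in>init G. \<exists>x\<in>trans_ext G x0 s. t \<in> lang_from G x)"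
  unfolding lang_def lang_from_def by (auto simp: trans_ext_append)

lemma K_step_iff:
  "K_step_strongly_anonymous G So \<Gamma> K \<longleftrightarrow>
     \<not> (\<exists>x. (x, {}) \<in> reachable_within K (Cc G So Suo \<Gamma>))"
proof -
  \<comment> \<open>A word \<open>s @ t\<close> of the language passes through some state
    \<open>x\<close> after \<open>s\<close>; quantifying over \<open>x\<close> replaces
    \<open>s\<close>, and \<beta> is forced to be \<open>obs t\<close>.\<close>
  have "K_step_strongly_anonymous G So \<Gamma> K \<longleftrightarrow>
    (\<forall>\<alpha>. \<forall>x \<in> post (init G) \<alpha>. \<forall>t \<in> lang_from G x. length (obs t) \<le> K \<longrightarrow>
        card (delayed_estimate G So \<Gamma> \<alpha> (\<alpha> @ obs t)) > 1)"
    unfolding K_step_strongly_anonymous_def append_in_lang_iff post_def by auto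
  also have "\<dots> \<longleftrightarrow>
    (\<forall>\<alpha>. \<forall>x \<in> post (init G) \<alpha>. \<forall>t \<in> lang_from G x. length (obs t) \<le> K \<longrightarrow>
        post (post (init G) \<alpha> - {x}) (obs t) \<noteq> {})"
  proof -
    have "card (delayed_estimate G So \<Gamma> \<alpha> (\<alpha> @ obs t)) > 1 \<longleftrightarrow>
        post (post (init G) \<alpha> - {x}) (obs t) \<noteq> {}"
      if "x \<in> post (init G) \<alpha>" "t \<in> lang_from G x" for \<alpha> x t
    proof -
      let ?E = "delayed_estimate G So \<Gamma> \<alpha> (\<alpha> @ obs t)"
      have "finite ?E"
        using is_nfa by (auto simp: is_nfa_def delayed_estimate_def)
      moreover have x: "x \<in> ?E" using that by (auto simp: delayed_estimate_eq)
      \<comment> \<open>As \<open>x\<close> lies in the finite set \<open>?E\<close>, having more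
        than one element means that something remains after removing \<open>x\<close>.\<close>
      ultimately have "card ?E > 1 \<longleftrightarrow> ?E - {x} \<noteq> {}"
        by (metis (no_types, lifting) card_Diff_singleton card_gt_0_iff finite_Diff zero_less_diff)
      also have "\<dots> \<longleftrightarrow> post (post (init G) \<alpha> - {x}) (obs t) \<noteq> {}"
        unfolding delayed_estimate_eq post_empty_iff by blast
      finally show ?thesis .
    qed
    then show ?thesis by blast
  qed
  finally show ?thesis unfolding reachable_within_Cc_iff by blast
qed

end

theorem theorem1:
  fixes G :: "('x, 'e) nfa" and So Suo \<Gamma> :: "'e set"
  assumes "is_nfa G"
    and "events G = So \<union> Suo" and "So \<inter> Suo = {}"
    and "\<Gamma> \<subseteq> So" and "card \<Gamma> \<ge> 2"
  shows "(infinite_step_strongly_anonymous G So \<Gamma> \<longleftrightarrow>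
            \<not> (\<exists>x. (x, {}) \<in> reachable (Cc G So Suo \<Gamma>))) \<and>
         (\<forall>K. K_step_strongly_anonymous G So \<Gamma> K \<longleftrightarrow>
            \<not> (\<exists>x. (x, {}) \<in> reachable_within K (Cc G So Suo \<Gamma>)))"
proof -
  interpret partially_observed_nfa G So Suo \<Gamma>
    using assms by unfold_locales
  show ?thesis
    unfolding infinite_step_iff_K_step K_step_iff reachable_iff_reachable_within by blast
qed

end
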